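(* Let $G$ be a finite simple connected graph with weight function $\omega:E(G)\to\{1,2,3,\dots\}$, let $p$ be a pebble distribution on $G_\omega$ and $x\in V(G)$. The following are equivalent: (1) $x$ is reachable from $p$; (2) there is a finite multiset $S$ of pebbling moves with $p_S\ge 0$ and $p_S(x)\ge 1$; (3) there is a finite acyclic multiset $R$ of pebbling moves with $p_R\ge 0$ and $p_R(x)\ge 1$; (4) $x$ is reachable from $p$ through a regular pebbling sequence, i.e. there is a regular sequence $s$ executable from $p$ with $p_s(x)\ge1$.
   Context: A pebble function is a map $p:V(G)\to\mathbb{Z}$; a pebble distribution is a nonnegative pebble function. For $vu\in E(G)$, the pebbling move $(v\to u)$ replaces $p$ by $p_{(v\to u)}$ with $p_{(v\to u)}(v)=p(v)-\omega(vu)$, $p_{(v\to u)}(u)=p(u)+1$, other values unchanged. For a sequence $s=(s_1,\dots,s_k)$ of moves, $p_s$ is the result of applying the moves in order; $s$ is executable from $p$ if $p_{(s_1,\dots,s_i)}\ge0$ for all $i$. The vertex $x$ is reachable from $p$ if there is a sequence $s$ executable from $p$ with $p_s(x)\ge 1$. For a finite multiset $S$ of moves, $p_S$ is the result of applying all moves of $S$ (order independent). The transition digraph $T(G,S)$ is the directed multigraph on $V(G)$ with one arc $(v,u)$ per copy of $(v\to u)$ in $S$; $S$ is acyclic if $T(G,S)$ has no directed cycle. An element $(v\to u)\in S$ is an initial move of $S$ if $v$ has in-degree $0$ in $T(G,S)$. A sequence $s=(s_1,\dots,s_k)$ is regular if, with $S$ the multiset of its moves, $s_i$ is an initial move of $S\setminus\{s_1,\dots,s_{i-1}\}$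 for all $i$. *)

theory Defs
  imports "Graph_Theory.Graph_Theory" "HOL-Library.Multiset"
begin

text \<open>
  A finite simple graph is a \<^term>\<open>pair_graph\<close>, i.e. a finite loop-free symmetric digraph
  without parallel arcs: the undirected edge \<open>vu\<close> is the pair of arcs \<open>(v, u)\<close> and \<open>(u, v)\<close>.
  The weight function lives on the undirected edges \<open>{v, u}\<close>, so it is symmetric by construction.
  The pebbling move \<open>(v \<rightarrow> u)\<close> is the pair \<open>(v, u)\<close>.  Values of a pebble
  function outside the vertex set are never inspected.
\<close>

type_synonym 'a move = "'a \<times> 'a"

definition weight_function :: "'a pair_pre_digraph \<Rightarrow> ('a set \<Rightarrow> nat) \<Rightarrow> bool" where
  "weight_function G \<omega> \<longleftrightarrow> (\<forall>(v, u) \<in> parcs G. 1 \<le> \<omega> {v, u})"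

definition pebble_distribution :: "'a pair_pre_digraph \<Rightarrow> ('a \<Rightarrow> int) \<Rightarrow> bool" where
  "pebble_distribution G p \<longleftrightarrow> (\<forall>v \<in> pverts G. 0 \<le> p v)"

fun apply_move :: "('a set \<Rightarrow> nat) \<Rightarrow> 'a move \<Rightarrow> ('a \<Rightarrow> int) \<Rightarrow> ('a \<Rightarrow> int)" where
  "apply_move \<omega> (v, u) p = p(v := p v - int (\<omega> {v, u}), u := p u + 1)"

definition apply_seq :: "('a set \<Rightarrow> nat) \<Rightarrow> 'a move list \<Rightarrow> ('a \<Rightarrow> int) \<Rightarrow> ('a \<Rightarrow> int)" where
  "apply_seq \<omega> s p = fold (apply_move \<omega>) s p"

text \<open>The fold over a multiset is meaningful because moves commute, see below.\<close>

definition apply_mset :: "('a set \<Rightarrow> nat) \<Rightarrow> 'a move multiset \<Rightarrow> ('a \<Rightarrow> int) \<Rightarrow> ('a \<Rightarrow> int)" where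
  "apply_mset \<omega> S p = fold_mset (apply_move \<omega>) p S"

lemma comp_fun_commute_apply_move: "comp_fun_commute (apply_move \<omega>)"
proof
  fix a b :: "'a move"
  show "apply_move \<omega> b \<circ> apply_move \<omega> a = apply_move \<omega> a \<circ> apply_move \<omega> b"
    by (cases a; cases b) (auto simp: fun_eq_iff)
qed

lemma apply_mset_mset: "apply_mset \<omega> (mset s) p = apply_seq \<omega> s p"
proof -
  interpret comp_fun_commute "apply_move \<omega>" by (rule comp_fun_commute_apply_move)
  have "fold_mset (apply_move \<omega>) p (mset s) = fold (apply_move \<omega>) s p"
  proof (induction s arbitrary: p)
    case (Cons m s)
    have "fold_mset (apply_move \<omega>) p (mset (m # s)) =
        fold_mset (apply_move \<omega>) (apply_move \<omega> m p) (mset s)"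
      by (simp add: fold_mset_fun_left_comm)
    with Cons.IH show ?case by simp
  qed simp
  then show ?thesis by (simp add: apply_mset_def apply_seq_def)
qed

definition executable :: "'a pair_pre_digraph \<Rightarrow> ('a set \<Rightarrow> nat) \<Rightarrow> ('a \<Rightarrow> int) \<Rightarrow> 'a move list \<Rightarrow> bool" where
  "executable G \<omega> p s \<longleftrightarrow>
     (\<forall>i \<in> {1..length s}. pebble_distribution G (apply_seq \<omega> (take i s) p))"

definition pebble_reachable :: "'a pair_pre_digraph \<Rightarrow> ('a set \<Rightarrow> nat) \<Rightarrow> ('a \<Rightarrow> int) \<Rightarrow> 'a \<Rightarrow> bool" where
  "pebble_reachable G \<omega> p x \<longleftrightarrow>
     (\<exists>s. set s \<subseteq> parcs G \<and> executable G \<omega> p s \<and> 1 \<le> apply_seq \<omega> s p x)"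

text \<open>The \<open>i\<close>-th copy of a move in \<open>S\<close> becomes an arc of its own, tagged with \<open>i\<close>.\<close>

definition transition_digraph ::
    "'a pair_pre_digraph \<Rightarrow> 'a move multiset \<Rightarrow> ('a, 'a move \<times> nat) pre_digraph" where
  "transition_digraph G S =
     \<lparr> verts = pverts G, arcs = {(m, i). i < count S m},
       tail = (\<lambda>(m, i). fst m), head = (\<lambda>(m, i). snd m) \<rparr>"

definition acyclic_moves :: "'a pair_pre_digraph \<Rightarrow> 'a move multiset \<Rightarrow> bool" where
  "acyclic_moves G S \<longleftrightarrow> \<not> (\<exists>c. pre_digraph.cycle (transition_digraph G S) c)"

definition initial_move :: "'a pair_pre_digraph \<Rightarrow> 'a move multiset \<Rightarrow> 'a move \<Rightarrow> bool" where
  "initial_move G S m \<longleftrightarrow> m \<in># S \<and> in_degree (transition_digraph G S) (fst m) = 0"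

definition regular_seq :: "'a pair_pre_digraph \<Rightarrow> 'a move list \<Rightarrow> bool" where
  "regular_seq G s \<longleftrightarrow>
     (\<forall>i < length s. initial_move G (mset s - mset (take i s)) (s ! i))"

lemma finite_arcs_transition_digraph: "finite (arcs (transition_digraph G S))"
proof -
  have "arcs (transition_digraph G S) = (SIGMA m : set_mset S. {..<count S m})"
    by (auto simp: transition_digraph_def simp flip: count_greater_zero_iff)
  then show ?thesis by simp
qed

end

theory Submission
  imports Defs
begin

text \<open>
  Moves commute, so \<open>p\<^sub>S\<close> depends on \<open>S\<close> additively.  The moves along a directed cycle take at
  least as many pebbles off each vertex as they put on it, so deleting directed
  cycles one after another preserves (2) and ends in (3).  In an acyclic nonempty multiset some arc starts at a source \<open>v\<close>; no move of the
  multiset adds pebbles to \<open>v\<close>, so nonnegativity at the end forces \<open>p(v)\<close> to be large enough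
  to execute that arc first, and one continues with the remaining moves.
\<close>

section \<open>Moves as additive changes of the pebble counts\<close>

definition move_gain :: "('a set \<Rightarrow> nat) \<Rightarrow> 'a \<Rightarrow> 'a move \<Rightarrow> int" where
  "move_gain \<omega> v m =
     (if snd m = v then 1 else 0) - (if fst m = v then int (\<omega> {fst m, snd m}) else 0)"

text \<open>On a loop the second update in \<open>apply_move\<close> would overwrite the first and
  the cost would be lost; distinct endpoints keep both contributions.\<close>

lemma apply_move_eq_gain:
  assumes "fst m \<noteq> snd m"
  shows "apply_move \<omega> m p v = p v + move_gain \<omega> v m"
  using assms by (cases m) (auto simp: move_gain_def)

lemma apply_seq_Nil [simp]: "apply_seq \<omega> [] p = p"
  and apply_seq_Cons [simp]: "apply_seq \<omega> (m # s) p = apply_seq \<omega> s (apply_move \<omega> m p)"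
  by (simp_all add: apply_seq_def)

lemma apply_mset_empty [simp]: "apply_mset \<omega> {#} p = p"
  by (simp add: apply_mset_def)

text \<open>Any listing of \<open>S\<close> can be extended by \<open>m\<close> in front, and
  \<open>apply_mset_mset\<close> evaluates both multisets along lists.\<close>

lemma apply_mset_add_mset [simp]:
  "apply_mset \<omega> (add_mset m S) p = apply_mset \<omega> S (apply_move \<omega> m p)"
proof -
  obtain s where "mset s = S"
    using ex_mset by blast
  then show ?thesis
    using apply_mset_mset[of \<omega> "m # s" p] apply_mset_mset[of \<omega> s "apply_move \<omega> m p"] by simp
qed

lemma apply_mset_eq_gain:
  assumes "\<forall>m \<in># S. fst m \<noteq> snd m"
  shows "apply_mset \<omega> S p v = p v + (\<Sum>m \<in># S. move_gain \<omega> v m)"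
  using assms by (induction S arbitrary: p) (simp_all add: apply_move_eq_gain)

section \<open>Directed cycles of the transition digraph and their deletion\<close>

lemma wf_digraph_transition_digraph:
  assumes "set_mset S \<subseteq> pverts G \<times> pverts G"
  shows "wf_digraph (transition_digraph G S)"
proof
  fix e assume "e \<in> arcs (transition_digraph G S)"
  then have "fst e \<in># S"
    by (auto simp: transition_digraph_def simp flip: count_greater_zero_iff)
  with assms show "tail (transition_digraph G S) e \<in> verts (transition_digraph G S)"
    "head (transition_digraph G S) e \<in> verts (transition_digraph G S)"
    by (auto simp: transition_digraph_def split: prod.splits)
qed

text \<open>Copies of one move share their ends, so reachability in the digraph is governed by the
  relation \<open>set_mset S\<close>.\<close>

lemma arcs_ends_transition_digraph: "arcs_ends (transition_digraph G S) = set_mset S"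
  by (force simp: transition_digraph_def arcs_ends_def arc_to_ends_def image_iff
      simp flip: count_greater_zero_iff)

text \<open>A relational cycle is a nonempty closed walk, and such a walk contains a digraph cycle.
  The relational form passes to subsets and, by finiteness, gives well-foundedness.\<close>

lemma acyclic_moves_imp_acyclic:
  assumes "set_mset S \<subseteq> pverts G \<times> pverts G" and "acyclic_moves G S"
  shows "acyclic (set_mset S)"
proof (rule ccontr)
  interpret T: wf_digraph "transition_digraph G S"
    using assms(1) by (rule wf_digraph_transition_digraph)
  assume "\<not> acyclic (set_mset S)"
  then obtain v where "v \<rightarrow>\<^sup>+\<^bsub>transition_digraph G S\<^esub> v"
    by (auto simp: acyclic_def arcs_ends_transition_digraph)
  then obtain c where "T.awalk v c v" "c \<noteq> []"
    by (auto simp: T.reachable1_awalk)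
  then have "\<exists>c. T.cycle c"
    by (intro T.closed_w_imp_cycle) (auto simp: T.closed_w_def)
  with assms(2) show False
    by (simp add: acyclic_moves_def)
qed

text \<open>Consecutive arcs share a vertex, so the heads are the tails shifted by one place. On a
  closed walk the two multisets coincide.\<close>

lemma cas_heads_tails:
  assumes "pre_digraph.cas T u c v"
  shows "{#u#} + image_mset (head T) (mset c) = image_mset (tail T) (mset c) + {#v#}"
  using assms
  by (induction c arbitrary: u) (auto simp: pre_digraph.cas.simps)

text \<open>The definition of a cycle makes the heads distinct; heads and tails form the same
  multiset.\<close>

lemma cycle_distinct_tails:
  assumes "pre_digraph.cycle T c"
  shows "distinct (map (tail T) c)"
proof -
  from assms obtain u where c: "pre_digraph.cas T u c u" "distinct (tl (pre_digraph.awalk_verts T u c))"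
    by (auto simp: pre_digraph.cycle_def pre_digraph.awalk_def)
  have "pre_digraph.awalk_verts T u c = u # map (head T) c" if "pre_digraph.cas T u c w" for u w
    using that by (induction c arbitrary: u)
      (auto simp: pre_digraph.cas.simps pre_digraph.awalk_verts.simps)
  with c have "distinct (map (head T) c)"
    by auto
  moreover have "mset (map (head T) c) = mset (map (tail T) c)"
    using cas_heads_tails[OF c(1)] by simp
  ultimately show ?thesis
    by (metis mset_eq_imp_distinct_iff)
qed

text \<open>Distinct tails force distinct moves, so each move is used at most once and membership in
  \<open>S\<close> already yields multiset inclusion.\<close>

lemma cycle_moves_subset_mset:
  assumes "pre_digraph.cycle (transition_digraph G S) c"
  shows "mset (map fst c) \<subseteq># S"
proof -
  have "map (tail (transition_digraph G S)) c = map fst (map fst c)"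
    by (auto simp: transition_digraph_def)
  with cycle_distinct_tails[OF assms] have "distinct (map fst c)"
    by (metis distinct_map)
  moreover have "set (map fst c) \<subseteq> set_mset S"
    using assms by (auto simp: pre_digraph.cycle_def pre_digraph.awalk_def transition_digraph_def
        simp flip: count_greater_zero_iff)
  ultimately show ?thesis
    by (metis mset_set_set mset_set_set_mset_msubset subset_imp_msubset_mset_set
        finite_set_mset subset_mset.order_trans)
qed

text \<open>A cycle enters \<open>v\<close> as often as it leaves; an entry adds one pebble and an
  exit costs at least one, the weights being positive.\<close>

lemma cycle_gain_nonpos:
  assumes "pre_digraph.cycle (transition_digraph G S) c"
    and "\<forall>m \<in> fst ` set c. 1 \<le> \<omega> {fst m, snd m}"
  shows "(\<Sum>m \<in># mset (map fst c). move_gain \<omega> v m) \<le> 0"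
proof -
  obtain u where "pre_digraph.cas (transition_digraph G S) u c u"
    using assms(1) by (auto simp: pre_digraph.cycle_def pre_digraph.awalk_def)
  from cas_heads_tails[OF this]
  have ends: "image_mset (snd \<circ> fst) (mset c) = image_mset (fst \<circ> fst) (mset c)"
    by (simp add: transition_digraph_def case_prod_beta' comp_def)
  let ?at = "\<lambda>w. if w = v then 1 else 0 :: int"
  have "(\<Sum>e \<in># mset c. ?at (snd (fst e))) = sum_mset (image_mset ?at (image_mset (snd \<circ> fst) (mset c)))"
    by (simp add: multiset.map_comp comp_def)
  also have "\<dots> = (\<Sum>e \<in># mset c. ?at (fst (fst e)))"
    unfolding ends by (simp add: multiset.map_comp comp_def)
  also have "\<dots> \<le> (\<Sum>e \<in># mset c.
      if fst (fst e) = v then int (\<omega> {fst (fst e), snd (fst e)}) else 0)"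
    using assms(2) by (intro sum_mset_mono) (fastforce)
  finally have "(\<Sum>e \<in># mset c. ?at (snd (fst e)))
      \<le> (\<Sum>e \<in># mset c. if fst (fst e) = v then int (\<omega> {fst (fst e), snd (fst e)}) else 0)" .
  moreover have "(\<Sum>m \<in># mset (map fst c). move_gain \<omega> v m) = (\<Sum>e \<in># mset c. ?at (snd (fst e)))
      - (\<Sum>e \<in># mset c. if fst (fst e) = v then int (\<omega> {fst (fst e), snd (fst e)}) else 0)"
    by (induction c) (simp_all add: move_gain_def)
  ultimately show ?thesis
    by linarith
qed

text \<open>The bound is pointwise, so it carries over both nonnegativity and the pebble on the
  target; \<open>R \<subseteq># S\<close> keeps the moves inside \<open>E\<close>.\<close>

lemma exists_acyclic_moves:
  assumes "\<forall>(v, u) \<in> E. v \<noteq> u \<and> 1 \<le> \<omega> {v, u}"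
    and "set_mset S \<subseteq> E"
  shows "\<exists>R. R \<subseteq># S \<and> acyclic_moves G R \<and> (\<forall>v. apply_mset \<omega> S p v \<le> apply_mset \<omega> R p v)"
  using assms(2)
proof (induction "size S" arbitrary: S rule: less_induct)
  case less
  show ?case
  proof (cases "acyclic_moves G S")
    case True
    then show ?thesis by blast
  next
    case False
    then obtain c where c: "pre_digraph.cycle (transition_digraph G S) c"
      by (auto simp: acyclic_moves_def)
    define C where "C = mset (map fst c)"
    have C: "C \<subseteq># S"
      unfolding C_def using c by (rule cycle_moves_subset_mset)
    \<comment> \<open>Cycles are nonempty by definition, so deleting one strictly lowers the
      size.\<close>
    have "C \<noteq> {#}"
      using c by (auto simp: C_def pre_digraph.cycle_def)
    with C have "size (S - C) < size S"
      by (metis size_Diff_submset diff_less nonempty_has_size size_mset_mono less_le_trans)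
    moreover have sub: "set_mset (S - C) \<subseteq> E"
      using less.prems by (meson in_diffD subset_iff)
    ultimately obtain R where R: "R \<subseteq># S - C" "acyclic_moves G R"
      "\<And>v. apply_mset \<omega> (S - C) p v \<le> apply_mset \<omega> R p v"
      using less.hyps by blast
    have "apply_mset \<omega> S p v \<le> apply_mset \<omega> (S - C) p v" for v
    proof -
      have "(\<Sum>m \<in># C. move_gain \<omega> v m) \<le> 0"
        unfolding C_def
      proof (rule cycle_gain_nonpos[OF c])
        have "fst ` set c = set_mset C"
          by (simp add: C_def)
        with set_mset_mono[OF C] have "fst ` set c \<subseteq> E"
          using less.prems by simp
        then show "\<forall>m \<in> fst ` set c. 1 \<le> \<omega> {fst m, snd m}"
          using assms(1) by (auto simp: split_beta)
      qed
      moreover have "(\<Sum>m \<in># S. move_gain \<omega> v m)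
          = (\<Sum>m \<in># S - C. move_gain \<omega> v m) + (\<Sum>m \<in># C. move_gain \<omega> v m)"
        using C by (metis image_mset_union sum_mset.union subset_mset.diff_add)
      moreover have "\<forall>m \<in># S. fst m \<noteq> snd m" "\<forall>m \<in># S - C. fst m \<noteq> snd m"
        using assms(1) less.prems sub by (auto simp: split_beta)
      ultimately show ?thesis
        by (simp add: apply_mset_eq_gain)
    qed
    with R show ?thesis
      by (meson diff_subset_eq_self order_trans subset_mset.order_trans)
  qed
qed

section \<open>Executable and regular sequences\<close>

lemma executable_Nil [simp]: "executable G \<omega> p []"
  by (simp add: executable_def)

lemma executable_Cons:
  "executable G \<omega> p (m # s) \<longleftrightarrow>
     pebble_distribution G (apply_move \<omega> m p) \<and> executable G \<omega> (apply_move \<omega> m p) s"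
proof -
  \<comment> \<open>The prefix of length 1 is \<open>m\<close> alone; a longer one is
    \<open>m\<close> followed by a nonempty prefix of \<open>s\<close>.\<close>
  have "{1..length (m # s)} = insert 1 (Suc ` {1..length s})"
    by (auto simp: image_Suc_atLeastAtMost)
  then show ?thesis
    by (simp add: executable_def del: image_Suc_atLeastAtMost)
qed

text \<open>The condition on \<open>p\<close> covers the empty sequence: \<open>executable\<close>
  inspects nonempty prefixes only.\<close>

lemma executable_imp_pebble_distribution:
  assumes "executable G \<omega> p s" and "pebble_distribution G p"
  shows "pebble_distribution G (apply_seq \<omega> s p)"
  using assms by (induction s arbitrary: p) (auto simp: executable_Cons)

lemma regular_seq_Nil [simp]: "regular_seq G []"
  by (simp add: regular_seq_def)

text \<open>Position 0 removes nothing; at position \<open>Suc i\<close> the copy of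
  \<open>m\<close> cancels, leaving position \<open>i\<close> of \<open>s\<close>.\<close>

lemma regular_seq_Cons:
  "regular_seq G (m # s) \<longleftrightarrow> initial_move G (add_mset m (mset s)) m \<and> regular_seq G s"
  by (auto simp: regular_seq_def less_Suc_eq_0_disj)

lemma initial_moveI:
  assumes "m \<in># S" and "\<forall>n \<in># S. snd n \<noteq> fst m"
  shows "initial_move G S m"
proof -
  have "in_arcs (transition_digraph G S) (fst m) = {}"
    using assms(2) by (auto simp: in_arcs_def transition_digraph_def simp flip: count_greater_zero_iff)
  with assms(1) show ?thesis
    by (simp add: initial_move_def in_degree_def)
qed

text \<open>A finite acyclic relation is well-founded, so the starting vertices of the moves have a
  minimal one.\<close>

lemma acyclic_mset_source:
  fixes S :: "'a move multiset"
  assumes "acyclic (set_mset S)" and "S \<noteq> {#}"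
  obtains m where "m \<in># S" and "\<forall>n \<in># S. snd n \<noteq> fst m"
proof -
  have "wf (set_mset S)"
    using assms(1) by (simp add: finite_acyclic_wf)
  moreover have "fst ` set_mset S \<noteq> {}"
    using assms(2) by simp
  ultimately obtain v where "v \<in> fst ` set_mset S"
    and *: "\<And>w. (w, v) \<in># S \<Longrightarrow> w \<notin> fst ` set_mset S"
    by (metis wfE_min')
  then obtain m where "m \<in># S" "v = fst m"
    by auto
  \<comment> \<open>A move into \<open>v\<close> would itself begin at a smaller starting
    vertex.\<close>
  moreover have "snd n \<noteq> v" if "n \<in># S" for n
    using *[of "fst n"] that by auto
  ultimately show thesis
    using that by blast
qed

text \<open>Induction on the size with \<open>p\<close> generalized: the remaining moves are played
  from the distribution after the first one and end in the same result.\<close>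

lemma acyclic_imp_regular_executable:
  assumes "acyclic (set_mset S)" and "\<forall>m \<in># S. fst m \<noteq> snd m"
    and "set_mset S \<subseteq> pverts G \<times> pverts G"
    and "pebble_distribution G p" and "pebble_distribution G (apply_mset \<omega> S p)"
  shows "\<exists>s. mset s = S \<and> regular_seq G s \<and> executable G \<omega> p s"
  using assms
proof (induction "size S" arbitrary: S p)
  case 0
  then show ?case
    by (intro exI[of _ "[]"]) simp
next
  case (Suc k)
  then have "S \<noteq> {#}"
    by auto
  then obtain m where m: "m \<in># S" "\<forall>n \<in># S. snd n \<noteq> fst m"
    using Suc.prems(1) acyclic_mset_source by blast
  define R where "R = S - {#m#}"
  define q where "q = apply_move \<omega> m p"
  have S: "S = add_mset m R"
    using m(1) by (simp add: R_def)
  have fin: "apply_mset \<omega> S p = apply_mset \<omega> R q"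
    by (simp add: S q_def)
  \<comment> \<open>No move of \<open>R\<close> ends at \<open>fst m\<close>, so the count there
    cannot rise after \<open>q\<close>; hence \<open>q\<close> is at least the nonnegative final
    value.\<close>
  have "0 \<le> q (fst m)"
  proof -
    have "(\<Sum>n \<in># R. move_gain \<omega> (fst m) n) \<le> (\<Sum>n \<in># R. 0)"
      using m(2) by (intro sum_mset_mono) (simp add: S move_gain_def)
    then have "apply_mset \<omega> R q (fst m) \<le> q (fst m)"
      using Suc.prems(2) by (simp add: S apply_mset_eq_gain)
    moreover have "0 \<le> apply_mset \<omega> R q (fst m)"
      using Suc.prems(3,5) m(1) by (auto simp: fin[symmetric] pebble_distribution_def)
    ultimately show ?thesis by simp
  qed
  \<comment> \<open>Only the start of \<open>m\<close> can lose pebbles.\<close>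
  moreover have "p v \<le> q v" if "v \<noteq> fst m" for v
    using that Suc.prems(2) m(1) by (simp add: q_def apply_move_eq_gain move_gain_def)
  ultimately have q: "pebble_distribution G q"
    using Suc.prems(4) unfolding pebble_distribution_def by (metis order_trans)
  have "\<exists>s. mset s = R \<and> regular_seq G s \<and> executable G \<omega> q s"
  proof (rule Suc.hyps(1))
    show "acyclic (set_mset R)"
      using Suc.prems(1) by (rule acyclic_subset) (auto simp: S)
  qed (use Suc.hyps(2) Suc.prems q fin in \<open>auto simp: S\<close>)
  then obtain s where s: "mset s = R" "regular_seq G s" "executable G \<omega> q s"
    by blast
  have "initial_move G S m"
    using m by (rule initial_moveI)
  with s q show ?case
    by (intro exI[of _ "m # s"]) (simp add: S regular_seq_Cons executable_Cons q_def)
qed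

theorem theorem3p4:
  fixes G :: "'a pair_pre_digraph" and \<omega> :: "'a set \<Rightarrow> nat"
    and p :: "'a \<Rightarrow> int" and x :: 'a
  assumes "pair_graph G" and "connected (with_proj G)"
    and "weight_function G \<omega>"
    and "pebble_distribution G p"
    and "x \<in> pverts G"
  shows "(pebble_reachable G \<omega> p x \<longleftrightarrow>
           (\<exists>S. set_mset S \<subseteq> parcs G \<and>
              pebble_distribution G (apply_mset \<omega> S p) \<and> 1 \<le> apply_mset \<omega> S p x))
       \<and> (pebble_reachable G \<omega> p x \<longleftrightarrow>
           (\<exists>R. set_mset R \<subseteq> parcs G \<and> acyclic_moves G R \<and>
              pebble_distribution G (apply_mset \<omega> R p) \<and> 1 \<le> apply_mset \<omega> R p x))
       \<and> (pebble_reachable G \<omega> p x \<longleftrightarrow>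
           (\<exists>s. set s \<subseteq> parcs G \<and> regular_seq G s \<and> executable G \<omega> p s \<and>
              1 \<le> apply_seq \<omega> s p x))"
    (is "(?reach \<longleftrightarrow> ?mset) \<and> (_ \<longleftrightarrow> ?acyc) \<and> (_ \<longleftrightarrow> ?reg)")
proof -
  interpret pair_graph G by fact
  \<comment> \<open>This makes the transition digraph on \<open>pverts G\<close> well
    formed.\<close>
  have verts: "parcs G \<subseteq> pverts G \<times> pverts G"
    by (auto dest: arc_fst_in_verts arc_snd_in_verts)
  have arcs: "\<forall>(v, u) \<in> parcs G. v \<noteq> u \<and> 1 \<le> \<omega> {v, u}"
    using assms(3) by (auto simp: weight_function_def dest: no_loops')
  \<comment> \<open>The implications run in a circle: reachability, multiset, acyclic multiset,
    regular sequence, reachability.\<close>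
  have "?mset" if ?reach
  proof -
    from that obtain s where "set s \<subseteq> parcs G" "executable G \<omega> p s" "1 \<le> apply_seq \<omega> s p x"
      by (auto simp: pebble_reachable_def)
    then show ?thesis
      using executable_imp_pebble_distribution assms(4)
      by (intro exI[of _ "mset s"]) (auto simp: apply_mset_mset)
  qed
  moreover have "?acyc" if ?mset
  proof -
    from that obtain S where S: "set_mset S \<subseteq> parcs G"
      "pebble_distribution G (apply_mset \<omega> S p)" "1 \<le> apply_mset \<omega> S p x"
      by blast
    obtain R where R: "R \<subseteq># S" "acyclic_moves G R"
      "\<And>v. apply_mset \<omega> S p v \<le> apply_mset \<omega> R p v"
      using exists_acyclic_moves[OF arcs S(1)] by blast
    then have "set_mset R \<subseteq> parcs G" "pebble_distribution G (apply_mset \<omega> R p)"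
      "1 \<le> apply_mset \<omega> R p x"
      using S by (auto simp: pebble_distribution_def dest: set_mset_mono intro: order_trans)
    with R(2) show ?thesis by blast
  qed
  moreover have "?reg" if ?acyc
  proof -
    from that obtain R where R: "set_mset R \<subseteq> parcs G" "acyclic_moves G R"
      "pebble_distribution G (apply_mset \<omega> R p)" "1 \<le> apply_mset \<omega> R p x"
      by blast
    have verts_R: "set_mset R \<subseteq> pverts G \<times> pverts G"
      using R(1) verts by blast
    have "\<forall>m \<in># R. fst m \<noteq> snd m"
      using R(1) arcs by (auto simp: split_beta)
    then obtain s where s: "mset s = R" "regular_seq G s" "executable G \<omega> p s"
      using acyclic_imp_regular_executable acyclic_moves_imp_acyclic assms(4) R(2,3) verts_R
      by metis
    \<comment> \<open>Since \<open>s\<close> lists \<open>R\<close>, playing \<open>s\<close> ends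
      in the value of \<open>apply_mset\<close> on \<open>R\<close>.\<close>
    then show ?thesis
      using R(1,4) by (intro exI[of _ s]) (auto simp: apply_mset_mset)
  qed
  moreover have "?reach" if ?reg
    using that by (auto simp: pebble_reachable_def)
  ultimately show ?thesis by blast
qed

end
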